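(* Let $\zeta\neq0$. The graviton-ghost propagator Feynman rule of (effective) Quantum General Relativity is $$\mathfrak{p}_{\rho_1|\rho_2}(p^2,\epsilon)=-\frac{2i\zeta}{p^2+i\epsilon}\,\eta_{\rho_1\rho_2};$$ that is, for every $p$ with $p^2\neq0$, $\mathfrak{p}(p^2,0)$ is the inverse of the graviton-ghost $2$-point vertex Feynman rule: $$\mathfrak{C}_2^{\rho_1|\rho_2}(p)\,\mathfrak{p}_{\rho_2|\rho_3}(p^2,0)=\delta^{\rho_1}_{\rho_3}.$$
   Context: Indices run over $0,\dots,3$, repeated indices are summed, $\eta=\mathrm{diag}(1,-1,-1,-1)$, $p^2=\eta_{\mu\nu}p^\mu p^\nu$. The graviton-ghost $2$-point vertex Feynman rule with gauge parameter $\zeta$ is $\mathfrak{C}_2^{\rho_1|\rho_2}(p)=\frac{i}{2\zeta}p^2\eta^{\rho_1\rho_2}$. The propagator is by definition its inverse, with a regulator $\epsilon$ for Landau singularities: $1/p^2$ is replaced by $1/(p^2+i\epsilon)$, and the value at $\epsilon=0$ is the inverse itself. *)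

theory Defs
  imports "HOL-Analysis.Analysis" "HOL-Computational_Algebra.Polynomial"
begin

text \<open>
  Lorentz indices are elements of the type \<open>4\<close>, i.e. 0, 1, 2, 3 (with 4 = 0).
  Upper and lower indices are not distinguished by type. The metric has the same
  components with upper and with lower indices, see \<open>minkowski_metric_inverse\<close>.
\<close>

definition minkowski_metric :: "real^4^4" ("\<eta>") where
  "\<eta> = (\<chi> \<mu> \<nu>. if \<mu> = \<nu> then (if \<mu> = 0 then 1 else -1) else 0)"

lemma minkowski_metric_inverse: "\<eta> ** \<eta> = mat 1"
proof -
  have "(\<Sum>k\<in>UNIV. \<eta> $ i $ k * \<eta> $ k $ j) = (if i = j then 1 else 0)" for i j :: 4
  proof -
    have "(\<Sum>k\<in>UNIV. \<eta> $ i $ k * \<eta> $ k $ j) = (\<Sum>k\<in>{i}. \<eta> $ i $ k * \<eta> $ k $ j)"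
      by (rule sum.mono_neutral_right) (auto simp: minkowski_metric_def)
    also have "\<dots> = (if i = j then 1 else 0)"
      by (simp add: minkowski_metric_def)
    finally show ?thesis .
  qed
  then show ?thesis
    by (simp add: matrix_matrix_mult_def mat_def vec_eq_iff)
qed

definition minkowski_square :: "real^4 \<Rightarrow> real" where
  "minkowski_square p = (\<Sum>\<mu>\<in>UNIV. \<Sum>\<nu>\<in>UNIV. \<eta> $ \<mu> $ \<nu> * p $ \<mu> * p $ \<nu>)"

definition ghost_vertex :: "real \<Rightarrow> real^4 \<Rightarrow> complex^4^4" where
  "ghost_vertex \<zeta> p =
     (\<chi> \<rho>\<^sub>1 \<rho>\<^sub>2. \<i> / (2 * of_real \<zeta>) * of_real (minkowski_square p) * of_real (\<eta> $ \<rho>\<^sub>1 $ \<rho>\<^sub>2))"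

text \<open>The first real argument after \<open>\<zeta>\<close> is the value of \<open>p\<^sup>2\<close>, the second is \<open>\<epsilon>\<close>.\<close>

definition ghost_propagator :: "real \<Rightarrow> real \<Rightarrow> real \<Rightarrow> complex^4^4" where
  "ghost_propagator \<zeta> s \<epsilon> =
     (\<chi> \<rho>\<^sub>1 \<rho>\<^sub>2. - (2 * \<i> * of_real \<zeta> / (of_real s + \<i> * of_real \<epsilon>)) * of_real (\<eta> $ \<rho>\<^sub>1 $ \<rho>\<^sub>2))"

text \<open>
  \<open>P\<close> is a propagator for the 2-point vertex \<open>C\<close> if \<open>P(p\<^sup>2, 0)\<close> is the inverse of \<open>C(p)\<close>
  and \<open>P(p\<^sup>2, \<epsilon>)\<close> results from it by replacing \<open>1/p\<^sup>2\<close> with \<open>1/(p\<^sup>2 + i\<epsilon>)\<close>.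
  The replacement is meaningful for an expression in \<open>1/p\<^sup>2\<close>: the entries of \<open>P\<close> are given by
  polynomials \<open>F\<close>, evaluated at \<open>1/p\<^sup>2\<close> for \<open>\<epsilon> = 0\<close> and at \<open>1/(p\<^sup>2 + i\<epsilon>)\<close> in general.
  Nothing is required where \<open>p\<^sup>2 + i\<epsilon> = 0\<close>.
\<close>

definition is_propagator :: "(real^4 \<Rightarrow> complex^4^4) \<Rightarrow> (real \<Rightarrow> real \<Rightarrow> complex^4^4) \<Rightarrow> bool" where
  "is_propagator C P \<longleftrightarrow>
     (\<forall>p. minkowski_square p \<noteq> 0 \<longrightarrow>
        C p ** P (minkowski_square p) 0 = mat 1 \<and> P (minkowski_square p) 0 ** C p = mat 1) \<and>
     (\<exists>F :: 4 \<Rightarrow> 4 \<Rightarrow> complex poly. \<forall>s \<epsilon>. of_real s + \<i> * of_real \<epsilon> \<noteq> 0 \<longrightarrow>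
        (\<forall>\<rho>\<^sub>1 \<rho>\<^sub>2. P s \<epsilon> $ \<rho>\<^sub>1 $ \<rho>\<^sub>2 = poly (F \<rho>\<^sub>1 \<rho>\<^sub>2) (1 / (of_real s + \<i> * of_real \<epsilon>))))"

end

theory Submission imports Defs begin

text \<open>
  The product of the two tensors is \<open>(\<i> p\<^sup>2 / (2 \<zeta>)) (- 2 \<i> \<zeta> / p\<^sup>2) \<eta> \<eta> = 1\<close>.
  Conversely, inverses are unique, and \<open>p\<^sup>2\<close> takes every positive value, so the entries of
  any propagator agree at infinitely many values of \<open>1/p\<^sup>2\<close> with a polynomial of degree at most one
  in \<open>1/p\<^sup>2\<close>. This fixes the polynomials, hence also the values at \<open>\<epsilon> \<noteq> 0\<close>.
\<close>

lemma minkowski_metric_sum: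
  "(\<Sum>k\<in>UNIV. \<eta> $ i $ k * \<eta> $ k $ j) = (if i = j then 1 else 0)"
  using arg_cong[OF minkowski_metric_inverse, of "\<lambda>M. M $ i $ j"]
  by (simp add: matrix_matrix_mult_def mat_def)

text \<open>The scalars factor out of the contraction, and \<eta> is its own inverse. Both orders of
  vertex and propagator are instances, with \<open>a\<close> and \<open>b\<close> as their
  prefactors.\<close>

lemma scaled_minkowski_mult:
  fixes a b :: complex
  assumes "a * b = 1"
  shows "(\<Sum>k\<in>UNIV. (a * of_real (\<eta> $ i $ k)) * (b * of_real (\<eta> $ k $ j))) = (if i = j then 1 else 0)"
proof -
  have "(\<Sum>k\<in>UNIV. (a * of_real (\<eta> $ i $ k)) * (b * of_real (\<eta> $ k $ j)))
      = a * b * of_real (\<Sum>k\<in>UNIV. \<eta> $ i $ k * \<eta> $ k $ j)"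
    by (simp add: sum_distrib_left mult_ac)
  then show ?thesis
    unfolding minkowski_metric_sum using assms by simp
qed

lemma ghost_vertex_propagator_sums:
  assumes "\<zeta> \<noteq> 0" "minkowski_square p \<noteq> 0"
  shows "(\<Sum>k\<in>UNIV. ghost_vertex \<zeta> p $ i $ k * ghost_propagator \<zeta> (minkowski_square p) 0 $ k $ j)
           = (if i = j then 1 else 0)"
    and "(\<Sum>k\<in>UNIV. ghost_propagator \<zeta> (minkowski_square p) 0 $ i $ k * ghost_vertex \<zeta> p $ k $ j)
           = (if i = j then 1 else 0)"
proof -
  let ?a = "\<i> / (2 * of_real \<zeta>) * of_real (minkowski_square p) :: complex"
  \<comment> \<open>The summand \<open>\<i> * of_real 0\<close> is kept so that \<open>?b\<close>
    matches the unfolded propagator at \<epsilon> = 0 literally.\<close>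
  let ?b = "- (2 * \<i> * of_real \<zeta> / (of_real (minkowski_square p) + \<i> * of_real 0)) :: complex"
  have ab: "?a * ?b = 1"
    using assms by (simp add: field_simps)
  then have ba: "?b * ?a = 1"
    by (simp only: mult.commute)
  show "(\<Sum>k\<in>UNIV. ghost_vertex \<zeta> p $ i $ k * ghost_propagator \<zeta> (minkowski_square p) 0 $ k $ j)
           = (if i = j then 1 else 0)"
    unfolding ghost_vertex_def ghost_propagator_def vec_lambda_beta
    by (rule scaled_minkowski_mult[OF ab])
  show "(\<Sum>k\<in>UNIV. ghost_propagator \<zeta> (minkowski_square p) 0 $ i $ k * ghost_vertex \<zeta> p $ k $ j)
           = (if i = j then 1 else 0)"
    unfolding ghost_vertex_def ghost_propagator_def vec_lambda_beta
    by (rule scaled_minkowski_mult[OF ba])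
qed

lemma ghost_vertex_propagator_inverse:
  assumes "\<zeta> \<noteq> 0" "minkowski_square p \<noteq> 0"
  shows "ghost_vertex \<zeta> p ** ghost_propagator \<zeta> (minkowski_square p) 0 = mat 1"
    and "ghost_propagator \<zeta> (minkowski_square p) 0 ** ghost_vertex \<zeta> p = mat 1"
  using ghost_vertex_propagator_sums[OF assms]
  by (simp_all add: matrix_matrix_mult_def mat_def vec_eq_iff)

text \<open>Vectors along the time axis realise every positive real as a value of
  \<open>minkowski_square\<close>.\<close>

lemma minkowski_square_timelike: "minkowski_square (axis 0 t) = t\<^sup>2"
proof -
  have "\<eta> $ \<mu> $ \<nu> * axis 0 t $ \<mu> * axis 0 t $ \<nu> = (if \<nu> = \<mu> then if \<mu> = 0 then t\<^sup>2 else 0 else 0)"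
    for \<mu> \<nu> :: 4
    by (simp add: minkowski_metric_def axis_def power2_eq_square)
  then show ?thesis
    by (simp add: minkowski_square_def)
qed

text \<open>The points 1/s exhaust the positive reals, and a nonzero difference \<open>F - G\<close>
  has only finitely many roots.\<close>

lemma poly_eqI_inverse_positive_reals:
  fixes F G :: "complex poly"
  assumes "\<And>s::real. s > 0 \<Longrightarrow> poly F (1 / of_real s) = poly G (1 / of_real s)"
  shows "F = G"
proof (rule ccontr)
  assume "F \<noteq> G"
  then have "finite {z. poly (F - G) z = 0}"
    by (intro poly_roots_finite) simp
  moreover have "complex_of_real ` {0<..} \<subseteq> {z. poly (F - G) z = 0}"
  proof clarify
    fix x :: real
    assume "x > 0"
    then show "poly (F - G) (of_real x) = 0"
      using assms[of "1 / x"] by simp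
  qed
  ultimately have "finite (complex_of_real ` {0<..})"
    by (rule rev_finite_subset)
  then have "finite {0::real<..}"
    by (rule finite_imageD) (simp add: inj_on_def)
  then show False
    using infinite_Ioi by blast
qed

definition ghost_poly :: "real \<Rightarrow> 4 \<Rightarrow> 4 \<Rightarrow> complex poly" where
  "ghost_poly \<zeta> i j = [:0, - (2 * \<i> * of_real \<zeta> * of_real (\<eta> $ i $ j)):]"

text \<open>Where the denominator vanishes both sides are 0: division by zero yields 0, and
  \<open>ghost_poly\<close> has constant coefficient 0.\<close>

lemma ghost_propagator_poly:
  "ghost_propagator \<zeta> s \<epsilon> $ i $ j = poly (ghost_poly \<zeta> i j) (1 / (of_real s + \<i> * of_real \<epsilon>))"
  by (simp add: ghost_propagator_def ghost_poly_def)

text \<open>\<open>is_propagator\<close> constrains its second argument only at nonzero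
  denominators; at \<epsilon> = 0 these are the s \<noteq> 0.\<close>

lemma is_propagator_cong:
  assumes "\<And>s \<epsilon>. complex_of_real s + \<i> * complex_of_real \<epsilon> \<noteq> 0 \<Longrightarrow> P s \<epsilon> = Q s \<epsilon>"
  shows "is_propagator C P \<longleftrightarrow> is_propagator C Q"
proof -
  have "P s 0 = Q s 0" if "s \<noteq> 0" for s
    using assms[of s 0] that by simp
  then show ?thesis
    unfolding is_propagator_def using assms by simp
qed

lemma is_propagator_ghost:
  assumes "\<zeta> \<noteq> 0"
  shows "is_propagator (ghost_vertex \<zeta>) (ghost_propagator \<zeta>)"
  unfolding is_propagator_def
  using ghost_vertex_propagator_inverse[OF assms] ghost_propagator_poly by blast

lemma is_propagator_ghost_unique:
  assumes "\<zeta> \<noteq> 0" and P: "is_propagator (ghost_vertex \<zeta>) P"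
    and nz: "complex_of_real s + \<i> * complex_of_real \<epsilon> \<noteq> 0"
  shows "P s \<epsilon> = ghost_propagator \<zeta> s \<epsilon>"
proof -
  obtain F where F: "\<And>s \<epsilon> i j. complex_of_real s + \<i> * complex_of_real \<epsilon> \<noteq> 0 \<Longrightarrow>
      P s \<epsilon> $ i $ j = poly (F i j) (1 / (of_real s + \<i> * of_real \<epsilon>))"
    using P unfolding is_propagator_def by blast
  have unregulated: "P s 0 = ghost_propagator \<zeta> s 0" if "s > 0" for s
  proof -
    \<comment> \<open>A timelike momentum whose square is the given s.\<close>
    define p :: "real^4" where "p = axis 0 (sqrt s)"
    have p: "minkowski_square p = s"
      using that by (simp add: p_def minkowski_square_timelike)
    have "P s 0 ** ghost_vertex \<zeta> p = mat 1"
      using P p that unfolding is_propagator_def by force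
    moreover have "ghost_vertex \<zeta> p ** ghost_propagator \<zeta> s 0 = mat 1"
      using ghost_vertex_propagator_inverse(1)[OF assms(1), of p] p that by simp
    ultimately show ?thesis
      \<comment> \<open>A left inverse and a right inverse of the same matrix coincide.\<close>
      by (metis matrix_mul_assoc matrix_mul_lid matrix_mul_rid)
  qed
  have "F i j = ghost_poly \<zeta> i j" for i j
  proof (rule poly_eqI_inverse_positive_reals)
    fix s :: real
    assume "s > 0"
    then show "poly (F i j) (1 / of_real s) = poly (ghost_poly \<zeta> i j) (1 / of_real s)"
      using F[of s 0 i j] unregulated[of s] ghost_propagator_poly[of \<zeta> s 0 i j] by simp
  qed
  \<comment> \<open>Equality of the polynomials, obtained at \<epsilon> = 0, carries over to the
    regulated argument.\<close>
  then show ?thesis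
    using F[OF nz] by (simp add: vec_eq_iff ghost_propagator_poly)
qed

theorem theorem4p14:
  fixes \<zeta> :: real
  assumes "\<zeta> \<noteq> 0"
  shows "(\<forall>P. is_propagator (ghost_vertex \<zeta>) P \<longleftrightarrow>
            (\<forall>s \<epsilon>. complex_of_real s + \<i> * complex_of_real \<epsilon> \<noteq> 0 \<longrightarrow>
               P s \<epsilon> = ghost_propagator \<zeta> s \<epsilon>)) \<and>
         (\<forall>p. minkowski_square p \<noteq> 0 \<longrightarrow>
            (\<forall>\<rho>\<^sub>1 \<rho>\<^sub>3. (\<Sum>\<rho>\<^sub>2\<in>UNIV. ghost_vertex \<zeta> p $ \<rho>\<^sub>1 $ \<rho>\<^sub>2 *
                ghost_propagator \<zeta> (minkowski_square p) 0 $ \<rho>\<^sub>2 $ \<rho>\<^sub>3)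
              = (if \<rho>\<^sub>1 = \<rho>\<^sub>3 then 1 else 0)))"
proof (intro conjI allI impI)
  fix P
  show "is_propagator (ghost_vertex \<zeta>) P \<longleftrightarrow>
          (\<forall>s \<epsilon>. complex_of_real s + \<i> * complex_of_real \<epsilon> \<noteq> 0 \<longrightarrow>
             P s \<epsilon> = ghost_propagator \<zeta> s \<epsilon>)"
    \<comment> \<open>Uniqueness gives the forward direction; the converse transfers the property
      from \<open>ghost_propagator \<zeta>\<close> to \<open>P\<close> by congruence.\<close>
    using is_propagator_ghost_unique[OF assms] is_propagator_ghost[OF assms]
      is_propagator_cong[of P "ghost_propagator \<zeta>"]
    by blast
qed (rule ghost_vertex_propagator_sums(1)[OF assms])

end
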